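(* Let $H\in\mathcal G$ be such that every element $h\in H$, written as $h=\varepsilon_Aq$ with $A\in RM(2,4)$ and $q\in Q$, has either $A\in RM(1,4)$ or $A$ of defect $2$, and suppose $|x_0H|=64$. Let $C=\Omega\setminus B_0$ (the affine hyperplane containing $\omega_1$ but not $\omega_0$) and $H^{**}=H\langle\varepsilon_C\rangle$. Then: (i) the spherical code obtained by scaling the elements of $x_0H^{**}$ to unit length has 128 elements and cosine set $\{-\tfrac14,0,\tfrac14\}$; (ii) the spherical code in $\mathbb{R}^{15}$ obtained by projecting $x_0H^{**}$ orthogonally onto $v_{\omega_0}^\perp$ and rescaling to unit length has 128 elements and cosine set $\{-\tfrac13,-\tfrac1{15},\tfrac15\}$.
   Context: A spherical code is a finite set of unit vectors; its cosines are the inner products of distinct members. Let $\Omega=\mathbb{F}_2^4$, $V=\mathbb{R}^{16}$ with orthonormal basis $(v_\omega)_{\omega\in\Omega}$, $x_0=\sum_\omega v_\omega$. For $A\subseteq\Omega$, $\varepsilon_A$ is the orthogonal map negating $v_\omega$ for $\omega\in A$ and fixing the others. Subsets of $\Omega$ are binary words (addition = symmetric difference); $RM(1,4)\subset RM(2,4)$ are the Reed–Muller codes on $\Omega$, $RM(r,4)$ spanned by affine subspaces of codimension $r$. Defect of $A\in RM(2,4)$: $A$ is the support of a Boolean function $F$ of degree $\le2$; the alternating form $B_F(u,w)=F(x+u+w)+F(x+u)+F(x+w)+F(x)$ has rank $2k$, and $k$ is the defect. Let $\omega_0=0$, fix $\omega_1\ne0$ and a linear hyperplane $B_0$ with $\omega_1\notin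 B_0$. Let $Q=\{g\in GL(4,2):\omega_1g=\omega_1, B_0g=B_0\}\cong GL(3,2)$ acting by permutation matrices $v_\omega\mapsto v_{\omega g}$. Let $E=\{\varepsilon_A:A\in RM(1,4),\ \omega_0,\omega_1\notin A\}$, $J=\{\varepsilon_A:A\in RM(2,4),\ \omega_0,\omega_1\notin A\}$, and let $\mathcal G$ be the set of subgroups $H$ with $E\le H\le JQ$ and $H/E\cong GL(3,2)$. *)

theory Defs
  imports
    "HOL-Analysis.Analysis"
    "HOL-Library.Z2"
    "HOL-Algebra.Coset"
    "HOL-Algebra.Generated_Groups"
begin

lemma UNIV_bit: "(UNIV :: bit set) = {0, 1}"
  by (auto intro: bit.exhaust)

instance bit :: finite
  by standard (simp only: UNIV_bit finite_insert finite.emptyI)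

type_synonym Omega = "bit ^ 4"

type_synonym V = "real ^ Omega"

abbreviation v :: "Omega \<Rightarrow> V"
  where "v \<omega> \<equiv> axis \<omega> 1"

definition x\<^sub>0 :: V
  where "x\<^sub>0 = (\<Sum>\<omega>\<in>UNIV. v \<omega>)"


section \<open>Matrix groups\<close>

text \<open>
  All groups act on the right: matrices act on row vectors by \<open>x v* M\<close>, so that
  \<open>M ** N\<close> means first \<open>M\<close>, then \<open>N\<close>.
\<close>

definition GL :: "('a::field ^ 'n ^ 'n) monoid"
  where "GL = \<lparr>carrier = {M. invertible M}, mult = (**), one = mat 1\<rparr>"

lemma group_GL: "group (GL :: ('a::field ^ 'n ^ 'n) monoid)"
proof (rule groupI)
  fix M :: "'a ^ 'n ^ 'n"
  assume "M \<in> carrier GL"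
  then show "\<exists>N\<in>carrier GL. N \<otimes>\<^bsub>GL\<^esub> M = \<one>\<^bsub>GL\<^esub>"
    by (auto simp: GL_def invertible_def)
qed (auto simp: GL_def invertible_mult matrix_mul_assoc invertible_def[of "mat 1"])

definition eps :: "Omega set \<Rightarrow> real ^ Omega ^ Omega"
  where "eps A = (\<chi> \<omega> \<omega>'. if \<omega> = \<omega>' then (if \<omega> \<in> A then - 1 else 1) else 0)"

definition perm_mat :: "bit ^ 4 ^ 4 \<Rightarrow> real ^ Omega ^ Omega"
  where "perm_mat g = (\<chi> \<omega> \<omega>'. if \<omega>' = \<omega> v* g then 1 else 0)"

lemma v_vector_matrix_mult: "(v \<omega> v* M) $ \<omega>' = M $ \<omega> $ \<omega>'"
  by (simp add: vector_matrix_mult_def axis_def if_distrib[of "\<lambda>x. x * _"] cong: if_cong)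

lemma v_eps: "v \<omega> v* eps A = (if \<omega> \<in> A then - v \<omega> else v \<omega>)"
  unfolding vec_eq_iff[where 'b = Omega]
  by (simp only: v_vector_matrix_mult) (simp add: eps_def axis_def)

lemma v_perm_mat: "v \<omega> v* perm_mat g = v (\<omega> v* g)"
  unfolding vec_eq_iff[where 'b = Omega]
  by (simp only: v_vector_matrix_mult) (simp add: perm_mat_def axis_def)


section \<open>Reed--Muller codes and defect\<close>

definition affine_subspace_codim :: "nat \<Rightarrow> (bit ^ 'n) set \<Rightarrow> bool"
  where "affine_subspace_codim r S \<longleftrightarrow>
    (\<exists>W a. vec.subspace W \<and> vec.dim W + r = CARD('n) \<and> S = (\<lambda>w. a + w) ` W)"

definition word :: "(bit ^ 'n) set \<Rightarrow> bit ^ (bit ^ 'n)"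
  where "word A = (\<chi> x. of_bool (x \<in> A))"

text \<open>
  Codewords are represented as subsets; the span is taken among their characteristic
  vectors, where symmetric difference becomes addition.
\<close>

lemma word_symm_diff: "word (sym_diff A B) = word A + word B"
  by (auto simp: word_def vec_eq_iff)

definition RM :: "nat \<Rightarrow> (bit ^ 'n) set set"
  where "RM r = {A. word A \<in> vec.span (word ` {S. affine_subspace_codim r S})}"

definition polar_form :: "(bit ^ 'n) set \<Rightarrow> bit ^ 'n \<Rightarrow> bit ^ 'n \<Rightarrow> bit ^ 'n \<Rightarrow> bit"
  where "polar_form A x u w =
    (let F = (\<lambda>y. of_bool (y \<in> A)) in F (x + u + w) + F (x + u) + F (x + w) + F x)"

text \<open>
  For \<open>A \<in> RM 2\<close> the form \<open>polar_form A x\<close> is alternating and does not depend on \<open>x\<close>; its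
  rank is that of its Gram matrix in the standard basis.
\<close>

definition has_defect :: "(bit ^ 'n) set \<Rightarrow> nat \<Rightarrow> bool"
  where "has_defect A k \<longleftrightarrow> A \<in> RM 2 \<and>
    (\<forall>x. rank ((\<chi> i j. polar_form A x (axis i 1) (axis j 1)) :: bit ^ 'n ^ 'n) = 2 * k)"


section \<open>The groups\<close>

text \<open>The base point \<open>\<omega>\<^sub>0\<close> is \<open>0\<close> throughout.\<close>

definition linear_hyperplane :: "(bit ^ 'n) set \<Rightarrow> bool"
  where "linear_hyperplane B \<longleftrightarrow> vec.subspace B \<and> vec.dim B + 1 = CARD('n)"

definition Q :: "Omega \<Rightarrow> Omega set \<Rightarrow> (real ^ Omega ^ Omega) set"
  where "Q \<omega>\<^sub>1 B\<^sub>0 =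
    perm_mat ` {g \<in> carrier GL. \<omega>\<^sub>1 v* g = \<omega>\<^sub>1 \<and> (\<lambda>\<omega>. \<omega> v* g) ` B\<^sub>0 = B\<^sub>0}"

definition E :: "Omega \<Rightarrow> (real ^ Omega ^ Omega) set"
  where "E \<omega>\<^sub>1 = eps ` {A \<in> RM 1. 0 \<notin> A \<and> \<omega>\<^sub>1 \<notin> A}"

definition J :: "Omega \<Rightarrow> (real ^ Omega ^ Omega) set"
  where "J \<omega>\<^sub>1 = eps ` {A \<in> RM 2. 0 \<notin> A \<and> \<omega>\<^sub>1 \<notin> A}"

definition \<G> :: "Omega \<Rightarrow> Omega set \<Rightarrow> (real ^ Omega ^ Omega) set set"
  where "\<G> \<omega>\<^sub>1 B\<^sub>0 = {H. subgroup H GL \<and> E \<omega>\<^sub>1 \<subseteq> H \<and> H \<subseteq> J \<omega>\<^sub>1 <#>\<^bsub>GL\<^esub> Q \<omega>\<^sub>1 B\<^sub>0 \<and>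
    (GL\<lparr>carrier := H\<rparr> Mod E \<omega>\<^sub>1) \<cong> (GL :: (bit ^ 3 ^ 3) monoid)}"

definition row_orbit :: "V \<Rightarrow> (real ^ Omega ^ Omega) set \<Rightarrow> V set"
  where "row_orbit x H = (\<lambda>h. x v* h) ` H"


section \<open>Spherical codes\<close>

definition spherical_code_in :: "'a::euclidean_space set \<Rightarrow> 'a set \<Rightarrow> bool"
  where "spherical_code_in U S \<longleftrightarrow> finite S \<and> S \<subseteq> U \<and> (\<forall>x\<in>S. norm x = 1)"

definition cosines :: "'a::euclidean_space set \<Rightarrow> real set"
  where "cosines S = {x \<bullet> y | x y. x \<in> S \<and> y \<in> S \<and> x \<noteq> y}"

definition rescale :: "'a::euclidean_space set \<Rightarrow> 'a set"
  where "rescale S = (\<lambda>x. x /\<^sub>R norm x) ` S"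

definition orth_proj :: "'a::euclidean_space set \<Rightarrow> 'a \<Rightarrow> 'a"
  where "orth_proj U x = (THE y. y \<in> U \<and> x - y \<in> U\<^sup>\<bottom>)"

lemma orth_proj_unit:
  fixes b :: "'a::euclidean_space"
  assumes "norm b = 1"
  shows "orth_proj ({b}\<^sup>\<bottom>) x = x - (x \<bullet> b) *\<^sub>R b"
  unfolding orth_proj_def
proof (rule the_equality)
  have bb: "b \<bullet> b = 1"
    using assms by (simp add: norm_eq_1)
  show "x - (x \<bullet> b) *\<^sub>R b \<in> {b}\<^sup>\<bottom> \<and> x - (x - (x \<bullet> b) *\<^sub>R b) \<in> {b}\<^sup>\<bottom>\<^sup>\<bottom>"
    using bb by (auto simp: orthogonal_comp_def orthogonal_def inner_diff_right inner_commute)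
  fix y assume y: "y \<in> {b}\<^sup>\<bottom> \<and> x - y \<in> {b}\<^sup>\<bottom>\<^sup>\<bottom>"
  define d where "d = x - (x \<bullet> b) *\<^sub>R b - y"
  have by0: "b \<bullet> y = 0"
    using y by (auto simp: orthogonal_comp_def orthogonal_def)
  have bd: "b \<bullet> d = 0"
    using by0 bb by (simp add: d_def inner_diff_right inner_commute)
  then have "d \<in> {b}\<^sup>\<bottom>"
    by (simp add: orthogonal_comp_def orthogonal_def)
  then have "d \<bullet> (x - y) = 0"
    using y by (auto simp: orthogonal_comp_def orthogonal_def)
  moreover have "x - y = d + (x \<bullet> b) *\<^sub>R b"
    by (simp add: d_def)
  ultimately have "d \<bullet> d = 0"
    using bd by (simp add: inner_add_right inner_commute)
  then show "y = x - (x \<bullet> b) *\<^sub>R b"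
    by (simp add: d_def)
qed

lemma dim_v_orthogonal_comp: "dim ({v \<omega>}\<^sup>\<bottom>) = 15"
proof -
  have "{v \<omega>}\<^sup>\<bottom> = {x. v \<omega> \<bullet> x = 0}"
    by (auto simp: orthogonal_comp_def orthogonal_def)
  moreover have "CARD(bit) = 2"
    by (subst UNIV_bit) simp
  moreover have "v \<omega> \<noteq> 0"
    by (simp add: axis_eq_0_iff)
  ultimately show ?thesis
    by (simp add: dim_hyperplane CARD_vec)
qed

end

theory Submission
  imports Defs
begin

text \<open>
  The orbit of \<open>x\<^sub>0\<close> under \<open>H**\<close> consists of \<open>\<plusminus>1\<close> vectors, and \<open>H**\<close> is orthogonal, so every inner
  product of two orbit vectors equals an inner product of \<open>x\<^sub>0\<close> or \<open>x\<^sub>0 \<epsilon>\<^sub>C\<close> with some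
  \<open>x\<^sub>0 h\<close>, \<open>h = \<epsilon>\<^sub>A q \<in> H\<close>. Since \<open>q\<close> fixes both \<open>x\<^sub>0\<close> and \<open>C\<close>, it is the signed sum
  of the word \<open>A\<close> or \<open>A + C\<close>. Words of \<open>RM(1,4)\<close> avoiding 0 give 16 or 0, and words of defect 2 are
  bent, hence give \<open>\<plusminus>4\<close>. If \<open>H\<close> contained no bent word, the 64 vectors of \<open>x\<^sub>0 H\<close> would be pairwise
  orthogonal in dimension 16. A bent word \<open>A\<close> yields both signs, because the words
  \<open>A + L\<close>, \<open>L\<close> linear, all occur (\<open>E\<close> provides the \<open>L\<close> vanishing at \<open>\<omega>\<^sub>1\<close>, adding \<open>C\<close> the others) and their
  16 signed sums add up to 16. Orbit vectors have entry 1 at \<open>\<omega>\<^sub>0\<close>, so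
  projecting lowers every inner product by 1.
\<close>


section \<open>Polar forms of Reed--Muller words\<close>

lemma bit_vec_add_self [simp]: "x + x = (0 :: bit ^ 'n)"
  by (simp add: vec_eq_iff)

lemma bit_vec_diff [simp]: "x - y = x + (y :: bit ^ 'n)"
  by (simp add: vec_eq_iff)

lemma bit_vec_two [simp]: "2 = (0 :: bit ^ 'n)"
  by (simp flip: one_add_one)

lemma bit_vec_add_add_self [simp]: "x + y + y = (x :: bit ^ 'n)" "y + (y + x) = x"
  by (metis add.assoc add.right_neutral bit_vec_add_self)
    (metis add.assoc add.left_neutral bit_vec_add_self)

text \<open>The only scalars are 0 and 1, so adjoining \<open>b\<close> to a subspace adds just one
  coset.\<close>

lemma span_insert_bit:
  fixes W :: "(bit ^ 'n) set"
  assumes "vec.subspace W"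
  shows "x \<in> vec.span (insert b W) \<longleftrightarrow> x \<in> W \<or> x + b \<in> W"
proof -
  have "x \<in> vec.span (insert b W) \<longleftrightarrow> (\<exists>k. x + k *s b \<in> W)"
    using assms by (simp add: vec.span_insert vec.span_eq_iff[THEN iffD2])
  also have "\<dots> \<longleftrightarrow> x \<in> W \<or> x + b \<in> W"
    by (metis (mono_tags) add.right_neutral bit_not_one_iff vector_smult_lid vector_smult_lzero)
  finally show ?thesis .
qed

lemma dim_span_insert:
  fixes W :: "('a::field ^ 'n) set"
  assumes "vec.subspace W" "b \<notin> W"
  shows "vec.dim (vec.span (insert b W)) = vec.dim W + 1"
  using assms by (simp add: vec.dim_insert vec.span_eq_iff[THEN iffD2])

text \<open>A hyperplane over F_2 has index 2: adjoining any outside vector spans everything, so the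
  complement is a single coset and non-membership is an additive map to F_2.\<close>

lemma linear_hyperplane_add_iff:
  assumes "linear_hyperplane W"
  shows "x + y \<in> W \<longleftrightarrow> (x \<in> W \<longleftrightarrow> y \<in> W)"
proof -
  have W: "vec.subspace W" and d: "vec.dim W + 1 = CARD('a)"
    using assms by (auto simp: linear_hyperplane_def)
  have "x + y \<in> W" if "x \<notin> W" "y \<notin> W"
  proof -
    have "vec.dim (vec.span (insert y W)) = vec.dimension TYPE(bit) TYPE('a)"
      using dim_span_insert[OF W that(2)] d by (simp add: vec.dimension_def card_cart_basis)
    then have "vec.span (insert y W) = UNIV"
      using vec.dim_eq_full[of "vec.span (insert y W)"] by (simp only: vec.span_span)
    then show ?thesis
      using span_insert_bit[OF W, of x y] that by auto
  qed
  moreover have "x + y \<in> W \<Longrightarrow> x \<in> W \<Longrightarrow> y \<in> W"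
    using vec.subspace_add[OF W, of "x + y" x] by (simp add: add.commute)
  moreover have "x + y \<in> W \<Longrightarrow> y \<in> W \<Longrightarrow> x \<in> W"
    using vec.subspace_add[OF W, of "x + y" y] by simp
  ultimately show ?thesis
    using vec.subspace_add[OF W] by blast
qed

text \<open>Take \<open>b1\<close> and \<open>b2\<close> independent modulo \<open>W\<close> and
  adjoin each of them to \<open>W\<close> separately.\<close>

lemma codim_2_eq_Int_hyperplanes:
  fixes W :: "(bit ^ 'n) set"
  assumes W: "vec.subspace W" and d: "vec.dim W + 2 = CARD('n)"
  obtains W1 W2 where "linear_hyperplane W1" "linear_hyperplane W2" "W = W1 \<inter> W2"
proof -
  have *: "\<exists>b. b \<notin> U" if "vec.dim U < CARD('n)" for U :: "(bit ^ 'n) set"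
    using that by (metis UNIV_eq_I less_irrefl vec_dim_card)
  obtain b1 where b1: "b1 \<notin> W"
    using *[of W] d by auto
  define W1 where "W1 = vec.span (insert b1 W)"
  have W1: "linear_hyperplane W1"
    using dim_span_insert[OF W b1] d by (simp add: linear_hyperplane_def W1_def)
  obtain b2 where b2: "b2 \<notin> W1"
    using *[of W1] W1 by (auto simp: linear_hyperplane_def)
  then have b2': "b2 \<notin> W"
    by (auto simp: W1_def span_insert_bit[OF W])
  define W2 where "W2 = vec.span (insert b2 W)"
  have W2: "linear_hyperplane W2"
    using dim_span_insert[OF W b2'] d by (simp add: linear_hyperplane_def W2_def)
  have "x \<in> W" if "x \<in> W1" "x \<in> W2" for x
  proof (rule ccontr)
    assume "x \<notin> W"
    with that have "x + b1 \<in> W" "x + b2 \<in> W"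
      by (auto simp: W1_def W2_def span_insert_bit[OF W])
    \<comment> \<open>A common vector outside \<open>W\<close> lies in both cosets
      \<open>W + b1\<close> and \<open>W + b2\<close>, which puts \<open>b1 + b2\<close> into
      \<open>W\<close> against the choice of \<open>b2\<close>.\<close>
    then have "(x + b1) + (x + b2) \<in> W"
      by (rule vec.subspace_add[OF W])
    also have "(x + b1) + (x + b2) = b2 + b1"
      by (metis add.assoc add.commute bit_vec_add_add_self(1))
    finally show False
      using b2 by (simp add: W1_def span_insert_bit[OF W])
  qed
  then have "W = W1 \<inter> W2"
    unfolding W1_def W2_def by (blast intro: vec.span_base)
  with W1 W2 that show thesis
    by blast
qed

lemma mem_translate_bit: "x \<in> (\<lambda>w. a + w) ` W \<longleftrightarrow> x + a \<in> (W :: (bit ^ 'n) set)"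
  proof
  assume "x + a \<in> W"
  then show "x \<in> (\<lambda>w. a + w) ` W"
    by (intro image_eqI[of _ _ "x + a"]) (simp_all add: add.commute)
qed (auto simp: add.commute)

lemma polar_form_word:
  "polar_form A x u w = word A $ (x + u + w) + word A $ (x + u) + word A $ (x + w) + word A $ x"
  by (simp add: polar_form_def word_def)

text \<open>The second difference is linear in the function and vanishes on the generators, because
  indicators of affine hyperplanes are affine functionals.\<close>

lemma polar_form_RM_1:
  assumes "A \<in> RM 1"
  shows "polar_form A x u w = 0"
proof -
  \<comment> \<open>\<open>D\<close> extends \<open>polar_form\<close> from sets to arbitrary
    functions, so that induction over the span applies.\<close>
  define D where "D f x u w = f $ (x + u + w) + f $ (x + u) + f $ (x + w) + f $ x"
    for f :: "bit ^ (bit ^ 'a)" and x u w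
  have "word A \<in> vec.span (word ` {S. affine_subspace_codim 1 S})"
    using assms by (simp add: RM_def)
  then have "\<forall>x u w. D (word A) x u w = 0"
  proof (induction rule: vec.span_induct_alt)
    case base
    then show ?case
      by (simp add: D_def)
  next
    case (step c f g)
    then obtain W a where W: "linear_hyperplane W"
      and f: "f = word ((\<lambda>w. a + w) ` W)"
      by (auto simp: affine_subspace_codim_def linear_hyperplane_def)
    have "D f x u w = 0" for x u w
      by (simp add: D_def f word_def mem_translate_bit linear_hyperplane_add_iff[OF W]) argo
    moreover have "D (c *s f + g) x u w = c * D f x u w + D g x u w" for x u w
      \<comment> \<open>The deleted rules would replace the ring operations by bit operations and
        block the ring normalisation.\<close>
      by (simp add: D_def algebra_simps del: add_bit_eq_xor mult_bit_eq_and)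
    ultimately show ?case
      using step by simp
  qed
  then show ?thesis
    by (simp add: polar_form_word D_def)
qed

text \<open>The indicator of a codimension 2 subspace is a product of two affine functionals, so its
  third differences vanish.\<close>

lemma polar_form_RM_2:
  assumes "A \<in> RM 2"
  shows "polar_form A x u w = polar_form A y u w"
proof -
  define D where "D f x u w = f $ (x + u + w) + f $ (x + u) + f $ (x + w) + f $ x"
    for f :: "bit ^ (bit ^ 'a)" and x u w
  have "word A \<in> vec.span (word ` {S. affine_subspace_codim 2 S})"
    using assms by (simp add: RM_def)
  then have "\<forall>x z u w. D (word A) (x + z) u w = D (word A) x u w"
  proof (induction rule: vec.span_induct_alt)
    case base
    then show ?case
      by (simp add: D_def)
  next
    case (step c f g)
    then obtain W a where W: "vec.subspace W" "vec.dim W + 2 = CARD('a)"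
      and f: "f = word ((\<lambda>w. a + w) ` W)"
      by (auto simp: affine_subspace_codim_def)
    obtain W1 W2 where W1: "linear_hyperplane W1" and W2: "linear_hyperplane W2"
      and W12: "W = W1 \<inter> W2"
      using codim_2_eq_Int_hyperplanes[OF W] by blast
    \<comment> \<open>\<open>k1\<close> and \<open>k2\<close> are the linear functionals with
      kernels \<open>W1\<close> and \<open>W2\<close>.\<close>
    define k1 k2 :: "bit ^ 'a \<Rightarrow> bit" where "k1 x = of_bool (x \<notin> W1)" and "k2 x = of_bool (x \<notin> W2)" for x
    have k1: "k1 (x + y) = k1 x + k1 y" and k2: "k2 (x + y) = k2 x + k2 y" for x y
      by (simp_all add: k1_def k2_def linear_hyperplane_add_iff[OF W1] linear_hyperplane_add_iff[OF W2])
    have f_eq: "f $ x = (1 + k1 x + k1 a) * (1 + k2 x + k2 a)" for x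
      by (simp add: f word_def mem_translate_bit W12 k1_def k2_def
          linear_hyperplane_add_iff[OF W1] linear_hyperplane_add_iff[OF W2])
    \<comment> \<open>The polar form of a product of two affine functionals is the symmetrised
      product of their linear parts, in which \<open>x\<close> no longer occurs.\<close>
    have "D f x u w = k1 u * k2 w + k1 w * k2 u" for x u w
      unfolding D_def f_eq k1 k2
      by (cases "k1 x"; cases "k2 x"; cases "k1 u"; cases "k2 u"; cases "k1 w"; cases "k2 w";
          cases "k1 a"; cases "k2 a"; simp)
    then have "D f (x + z) u w = D f x u w" for x z u w
      by simp
    moreover have "D (c *s f + g) x u w = c * D f x u w + D g x u w" for x u w
      by (simp add: D_def algebra_simps del: add_bit_eq_xor mult_bit_eq_and)
    ultimately show ?case
      using step by simp
  qed
  from this[rule_format, of x "x + y"] show ?thesis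
    by (simp add: polar_form_word D_def)
qed


section \<open>Signed sums of linear and bent words\<close>

lemma RM_sym_diff: "A \<in> RM r \<Longrightarrow> B \<in> RM r \<Longrightarrow> sym_diff A B \<in> RM r"
  by (simp only: RM_def mem_Collect_eq word_symm_diff vec.span_add)

lemma empty_in_RM: "({} :: (bit ^ 'n) set) \<in> RM r"
proof -
  have "word {} = (0 :: bit ^ (bit ^ 'n))"
    by (simp add: word_def vec_eq_iff)
  then show ?thesis
    by (simp add: RM_def vec.span_zero)
qed

text \<open>The complement is the other coset of \<open>B\<close>, hence itself a generator of the
  code.\<close>

lemma Compl_hyperplane_RM_1:
  assumes B: "linear_hyperplane B" and b: "b \<notin> B"
  shows "UNIV - B \<in> RM 1"
proof -
  have "UNIV - B = (\<lambda>w. b + w) ` B"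
    using b by (auto simp: mem_translate_bit linear_hyperplane_add_iff[OF B])
  then have "affine_subspace_codim 1 (UNIV - B)"
    using B unfolding affine_subspace_codim_def linear_hyperplane_def by blast
  then show ?thesis
    by (auto simp: RM_def intro: vec.span_base)
qed

definition bdot :: "bit ^ 'n \<Rightarrow> bit ^ 'n \<Rightarrow> bit"
  where "bdot a x = (\<Sum>i\<in>UNIV. a $ i * x $ i)"

lemma bdot_add_left: "bdot (a + b) x = bdot a x + bdot b x"
  and bdot_add_right: "bdot a (x + y) = bdot a x + bdot a y"
  by (simp_all add: bdot_def distrib_left distrib_right sum.distrib
      del: add_bit_eq_xor mult_bit_eq_and)

lemma bdot_zero [simp]: "bdot 0 x = 0" "bdot a 0 = 0"
  by (simp_all add: bdot_def)

lemma bdot_commute: "bdot a x = bdot x a"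
  by (simp add: bdot_def mult.commute del: mult_bit_eq_and)

lemma bdot_scale_right: "bdot a (c *s x) = c * bdot a x"
  by (simp add: bdot_def sum_distrib_left mult.left_commute del: mult_bit_eq_and)

lemma ex_bdot_eq_1:
  assumes "a \<noteq> 0"
  obtains b where "bdot a b = 1"
proof -
  obtain i where "a $ i \<noteq> 0"
    using assms by (auto simp: vec_eq_iff)
  then have "bdot a (axis i 1) = 1"
    by (simp add: bdot_def axis_def if_distrib cong: if_cong del: mult_bit_eq_and)
  then show thesis ..
qed

text \<open>Supports of the linear functionals, indexed so that sums over all of them become sums
  over \<open>UNIV\<close>; \<open>a = 0\<close> gives the empty word.\<close>

definition lin_word :: "bit ^ 'n \<Rightarrow> (bit ^ 'n) set"
  where "lin_word a = {x. bdot a x = 1}"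

lemma zero_notin_lin_word [simp]: "0 \<notin> lin_word a"
  by (simp add: lin_word_def)

text \<open>For nonzero \<open>a\<close> the kernel of the functional is a hyperplane, since any
  \<open>b\<close> of value 1 spans the rest, and the word is its complement.\<close>

lemma lin_word_RM_1: "lin_word a \<in> RM 1"
proof (cases "a = 0")
  case True
  then show ?thesis
    by (simp add: lin_word_def empty_in_RM)
next
  case False
  then obtain b where b: "bdot a b = 1"
    by (rule ex_bdot_eq_1)
  define W where "W = {x. bdot a x = 0}"
  have W: "vec.subspace W"
    by (auto simp: W_def vec.subspace_def bdot_add_right bdot_scale_right)
  have bW: "b \<notin> W"
    using b by (simp add: W_def)
  have "vec.span (insert b W) = UNIV"
  proof -
    have "x \<in> W \<or> x + b \<in> W" for x
      using b by (cases "bdot a x") (simp_all add: W_def bdot_add_right)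
    then show ?thesis
      by (auto simp: span_insert_bit[OF W])
  qed
  then have "vec.dim W + 1 = CARD('a)"
    using dim_span_insert[OF W bW] by (simp only: vec_dim_card)
  then have "linear_hyperplane W"
    using W by (simp add: linear_hyperplane_def)
  then have "UNIV - W \<in> RM 1"
    using bW by (rule Compl_hyperplane_RM_1)
  also have "UNIV - W = lin_word a"
    by (auto simp: W_def lin_word_def)
  finally show ?thesis .
qed

lemma card_bit: "CARD(bit) = 2"
  by (subst UNIV_bit) simp

text \<open>The function (-1)^F for the indicator F of \<open>A\<close>; its total is the Walsh
  coefficient of F at 0.\<close>

definition sg :: "'a set \<Rightarrow> 'a \<Rightarrow> real"
  where "sg A x = (if x \<in> A then - 1 else 1)"

lemma sg_square [simp]: "sg A x * sg A x = 1" "sg A x * (sg A x * c) = c"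
  by (simp_all add: sg_def)

lemma sg_sym_diff: "sg (sym_diff A B) x = sg A x * sg B x"
  by (auto simp: sg_def)

lemma sg_polar_form:
  "sg A x * sg A (x + u) * sg A (x + w) * sg A (x + u + w) =
    (if polar_form A x u w = 0 then 1 else - 1)"
  by (simp add: sg_def polar_form_def)

text \<open>Translation by \<open>w\<close> permutes the points and negates the sum, so the sum
  equals its own negative.\<close>

lemma sum_flip:
  fixes f :: "bit ^ 'n \<Rightarrow> real"
  assumes "\<And>x. f (x + w) = - f x"
  shows "sum f UNIV = 0"
proof -
  have "sum f UNIV = (\<Sum>x\<in>UNIV. f (x + w))"
    by (rule sum.reindex_bij_witness[of _ "\<lambda>x. x + w" "\<lambda>x. x + w"]) simp_all
  also have "\<dots> = - sum f UNIV"
    by (simp add: assms sum_negf)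
  finally show ?thesis
    by simp
qed

text \<open>Orthogonality of characters: for nonzero \<open>x\<close>, shifting \<open>a\<close> by
  some \<open>b\<close> with \<open>bdot x b = 1\<close> flips every sign.\<close>

lemma sum_sg_lin_word:
  "(\<Sum>a\<in>UNIV. sg (lin_word a) x) = (if x = 0 then 2 ^ CARD('n) else 0)" for x :: "bit ^ 'n"
proof (cases "x = 0")
  case True
  with True show ?thesis
    by (simp add: sg_def card_bit)
next
  case False
  then obtain b where "bdot x b = 1"
    by (rule ex_bdot_eq_1)
  then have "sg (lin_word (a + b)) x = - sg (lin_word a) x" for a
    by (simp add: sg_def lin_word_def bdot_add_left bdot_commute[of b])
  then have "(\<Sum>a\<in>UNIV. sg (lin_word a) x) = 0"
    by (rule sum_flip)
  with False show ?thesis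
    by simp
qed

text \<open>Vanishing polar form and value 0 at 0 make the indicator additive, so translation by any
  \<open>w\<close> in \<open>A\<close> flips the sign.\<close>

lemma sum_sg_RM_1:
  fixes A :: "(bit ^ 'n) set"
  assumes A: "A \<in> RM 1" and "0 \<notin> A" and "A \<noteq> {}"
  shows "(\<Sum>x\<in>UNIV. sg A x) = 0"
proof -
  obtain w where w: "w \<in> A"
    using assms by blast
  have "sg A (x + w) = - sg A x" for x
    using sg_polar_form[of A 0 x w] w assms(2) polar_form_RM_1[OF A, of 0 x w]
    by (simp add: sg_def split: if_splits)
  then show ?thesis
    by (rule sum_flip)
qed

lemma additive_bit_eq_sum:
  fixes g :: "bit ^ 'n \<Rightarrow> bit"
  assumes g: "\<And>x y. g (x + y) = g x + g y"
  shows "g x = (\<Sum>i\<in>UNIV. x $ i * g (axis i 1))"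
proof -
  interpret g: Modules.additive g
    by standard (rule g)
  have "g (c *s y) = c * g y" for c y
    by (cases c) (simp_all add: g.zero)
  moreover have "g (\<Sum>i\<in>UNIV. x $ i *s axis i 1) = (\<Sum>i\<in>UNIV. g (x $ i *s axis i 1))"
    by (rule g.sum)
  ultimately show ?thesis
    by (simp only: basis_expansion)
qed

text \<open>The square of the total is the sum of all autocorrelations of \<open>s\<close>. Bentness
  kills those with nonzero shift, leaving the number of points. Stating this for sign functions
  makes it applicable to products of two words.\<close>

lemma sum_bent_square:
  fixes s :: "bit ^ 'n \<Rightarrow> real"
  assumes s: "\<And>x. s x * s x = 1"
    and bent: "\<And>u. u \<noteq> 0 \<Longrightarrow> \<exists>w. \<forall>x. s x * s (x + u) * s (x + w) * s (x + u + w) = - 1"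
  shows "(sum s UNIV)\<^sup>2 = 2 ^ CARD('n)"
proof -
  have *: "(\<Sum>x\<in>UNIV. s x * s (x + u)) = (if u = 0 then 2 ^ CARD('n) else 0)" for u
  proof (cases "u = 0")
    case True
    with True show ?thesis
      by (simp add: s card_bit)
  next
    case False
    then obtain w where w: "s x * s (x + u) * (s (x + w) * s (x + w + u)) = - 1" for x
      using bent[OF False] by (auto simp: ac_simps)
    \<comment> \<open>Both factors are signs and their product is -1, so they are opposite: the
      derivative in direction \<open>u\<close> flips under translation by \<open>w\<close>.\<close>
    have "s (x + w) * s (x + w + u) = - (s x * s (x + u))" for x
    proof -
      have "(s x * s (x + u)) * (s x * s (x + u)) = (s x * s x) * (s (x + u) * s (x + u))"
        by (simp only: ac_simps)
      then have 1: "(s x * s (x + u)) * (s x * s (x + u)) = 1"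
        by (simp only: s mult_1_left)
      have "s (x + w) * s (x + w + u) =
          (s x * s (x + u)) * (s x * s (x + u) * (s (x + w) * s (x + w + u)))"
        by (simp only: mult.assoc[symmetric] 1[unfolded mult.assoc[symmetric]] mult_1_left)
      then show ?thesis
        by (simp only: w)
    qed
    then have "(\<Sum>x\<in>UNIV. s x * s (x + u)) = 0"
      by (rule sum_flip)
    with False show ?thesis
      by simp
  qed
  have "(sum s UNIV)\<^sup>2 = (\<Sum>x\<in>UNIV. s x * sum s UNIV)"
    by (simp add: power2_eq_square sum_distrib_right)
  also have "\<dots> = (\<Sum>x\<in>UNIV. s x * (\<Sum>u\<in>UNIV. s (x + u)))"
  proof (rule sum.cong)
    fix x :: "bit ^ 'n"
    have "sum s UNIV = (\<Sum>u\<in>UNIV. s (x + u))"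
      by (rule sum.reindex_bij_witness[of _ "\<lambda>u. x + u" "\<lambda>u. x + u"]) (simp_all flip: add.assoc)
    then show "s x * sum s UNIV = s x * (\<Sum>u\<in>UNIV. s (x + u))"
      by simp
  qed simp
  also have "\<dots> = (\<Sum>u\<in>UNIV. \<Sum>x\<in>UNIV. s x * s (x + u))"
    unfolding sum_distrib_left by (rule sum.swap)
  also have "\<dots> = 2 ^ CARD('n)"
    by (simp add: *)
  finally show ?thesis .
qed

text \<open>Full rank makes the Gram matrix injective, so some basis vector pairs to 1 with
  \<open>u\<close>; independence of the base point makes this uniform in \<open>x\<close>.\<close>

lemma polar_form_nondegenerate:
  fixes A :: "(bit ^ 'n) set"
  assumes d: "has_defect A k" and k: "2 * k = CARD('n)" and u: "u \<noteq> 0"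
  obtains w where "\<And>x. polar_form A x u w = 1"
proof -
  have A: "A \<in> RM 2"
    using d by (simp add: has_defect_def)
  define b where "b = polar_form A 0"
  have b: "polar_form A x = b" for x
    unfolding b_def by (intro ext) (rule polar_form_RM_2[OF A])
  define M :: "bit ^ 'n ^ 'n" where "M = (\<chi> i j. b (axis i 1) (axis j 1))"
  have "rank M = CARD('n)"
    using d k unfolding has_defect_def b M_def by simp
  then have "vec.span (rows M) = UNIV"
    using vec.dim_eq_full[of "rows M"]
    by (simp add: row_rank_def_gen vec.dimension_def card_cart_basis)
  then have "\<exists>N. N ** M = mat 1"
    by (simp add: matrix_left_invertible_span_rows_gen)
  then have "M *v u \<noteq> 0"
    using u matrix_left_invertible_ker[of M] by blast
  then obtain i where i: "(\<Sum>j\<in>UNIV. M $ i $ j * u $ j) \<noteq> 0"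
    by (auto simp: vec_eq_iff matrix_vector_mult_def)
  \<comment> \<open>Second differences at the base points 0 and \<open>x\<close> telescope;
    identifying the two forms gives additivity.\<close>
  have "b (axis i 1) (x + y) = b (axis i 1) x + b (axis i 1) y" for x y
  proof -
    have "polar_form A 0 (axis i 1) (x + y) = polar_form A x (axis i 1) y + polar_form A 0 (axis i 1) x"
      by (simp add: polar_form_def ac_simps) argo
    then show ?thesis
      by (simp only: b add.commute)
  qed
  from additive_bit_eq_sum[of "b (axis i 1)", OF this]
  have "b (axis i 1) u = (\<Sum>j\<in>UNIV. u $ j * b (axis i 1) (axis j 1))" .
  with i have "b (axis i 1) u \<noteq> 0"
    by (simp only: M_def vec_lambda_beta mult.commute) simp
  then have "b u (axis i 1) = 1"
    by (simp add: b_def polar_form_def ac_simps) argo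
  then show thesis
    using that b by simp
qed

text \<open>Defect 2 means rank 4, the full dimension. Multiplying by \<open>sg L\<close> leaves the
  polar form unchanged, so the product is again bent and its total squares to 16.\<close>

lemma sum_sg_defect_2:
  fixes A :: "Omega set"
  assumes d: "has_defect A 2" and L: "L \<in> RM 1"
  shows "(\<Sum>x\<in>UNIV. sg A x * sg L x) \<in> {4, - 4}"
proof -
  have "(\<Sum>x\<in>UNIV. sg A x * sg L x)\<^sup>2 = 2 ^ CARD(4)"
  proof (rule sum_bent_square)
    fix u :: Omega assume "u \<noteq> 0"
    then obtain w where w: "\<And>x. polar_form A x u w = 1"
      using polar_form_nondegenerate[OF d] by auto
    have "sg A x * sg L x * (sg A (x + u) * sg L (x + u)) * (sg A (x + w) * sg L (x + w)) *
        (sg A (x + u + w) * sg L (x + u + w)) =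
      (sg A x * sg A (x + u) * sg A (x + w) * sg A (x + u + w)) *
      (sg L x * sg L (x + u) * sg L (x + w) * sg L (x + u + w))" for x
      by (simp only: ac_simps)
    also have "\<dots> x = - 1" for x
      by (simp only: sg_polar_form w polar_form_RM_1[OF L]) simp
    finally show "\<exists>w. \<forall>x. sg A x * sg L x * (sg A (x + u) * sg L (x + u)) * (sg A (x + w) * sg L (x + w)) *
        (sg A (x + u + w) * sg L (x + u + w)) = - 1"
      by blast
  qed (simp add: ac_simps)
  also have "\<dots> = 4\<^sup>2"
    by simp
  finally show ?thesis
    unfolding power2_eq_iff by simp
qed

text \<open>The sums over all linear \<open>L\<close> add up to 16 by inversion of the Walsh--Hadamard transform,
  so they are neither all 4 nor all -4.\<close>

lemma sum_sg_defect_2_attained: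
  fixes A :: "Omega set"
  assumes d: "has_defect A 2" and 0: "0 \<notin> A" and c: "c \<in> {4, - 4}"
  obtains a where "(\<Sum>x\<in>UNIV. sg A x * sg (lin_word a) x) = c"
proof (rule ccontr)
  assume "\<not> thesis"
  then have "(\<Sum>x\<in>UNIV. sg A x * sg (lin_word a) x) = - c" for a
    using sum_sg_defect_2[OF d lin_word_RM_1[of a]] c that by force
  then have "(\<Sum>a\<in>UNIV. \<Sum>x\<in>UNIV. sg A x * sg (lin_word a) x) = - c * real CARD(Omega)"
    by simp
  also have "real CARD(Omega) = 16"
    by (simp add: card_bit)
  also have "(\<Sum>a\<in>UNIV. \<Sum>x\<in>UNIV. sg A x * sg (lin_word a) x) =
      (\<Sum>x\<in>UNIV. sg A x * (\<Sum>a\<in>UNIV. sg (lin_word a) x))"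
    unfolding sum_distrib_left by (rule sum.swap)
  also have "\<dots> = 16 * sg A 0"
    by (simp add: sum_sg_lin_word if_distrib[of "\<lambda>t. _ * t"] cong: if_cong)
  finally show False
    using 0 c by (simp add: sg_def)
qed


section \<open>The orbit of the all-ones vector\<close>

lemma x0_component [simp]: "x\<^sub>0 $ \<omega> = 1"
  by (simp add: x\<^sub>0_def axis_def)

lemma vector_matrix_mult_eps: "(x v* eps A) $ \<omega> = x $ \<omega> * sg A \<omega>"
  by (simp add: vector_matrix_mult_def eps_def sg_def if_distrib[of "\<lambda>t. _ * t"] cong: if_cong)

lemma bij_vector_matrix_mult:
  fixes g :: "'a::field ^ 'n ^ 'n"
  assumes "invertible g"
  shows "bij (\<lambda>x. x v* g)"
proof -
  obtain g' where "g ** g' = mat 1" "g' ** g = mat 1"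
    using assms by (auto simp: invertible_def)
  then show ?thesis
    by (intro o_bij[of "\<lambda>x. x v* g'"]) (auto simp: vector_matrix_mul_assoc fun_eq_iff)
qed

lemma vector_matrix_mult_perm_mat:
  assumes "invertible g"
  shows "(x v* perm_mat g) $ (\<omega> v* g) = x $ \<omega>"
proof -
  have "(\<omega> v* g = \<omega>' v* g) = (\<omega>' = \<omega>)" for \<omega>'
    using bij_vector_matrix_mult[OF assms] by (auto simp: bij_def dest: injD)
  then show ?thesis
    by (simp add: vector_matrix_mult_def perm_mat_def if_distrib[of "\<lambda>t. _ * t"] cong: if_cong)
qed

text \<open>Images under \<open>perm_mat g\<close> are known explicitly only at the coordinates
  \<open>\<omega> v* g\<close>; by surjectivity these are all coordinates.\<close>

lemma vec_eq_perm_iff: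
  fixes g :: "bit ^ 4 ^ 4"
  assumes "invertible g"
  shows "x = (y :: V) \<longleftrightarrow> (\<forall>\<omega>. x $ (\<omega> v* g) = y $ (\<omega> v* g))"
proof
  assume *: "\<forall>\<omega>. x $ (\<omega> v* g) = y $ (\<omega> v* g)"
  have "x $ \<omega> = y $ \<omega>" for \<omega>
    using surjD[OF bij_is_surj[OF bij_vector_matrix_mult[OF assms]], of \<omega>] * by auto
  then show "x = y"
    by (simp add: vec_eq_iff)
qed simp

lemma inner_eps: "(x v* eps A) \<bullet> (y v* eps A) = x \<bullet> y"
proof -
  have "(x $ i * sg A i) * (y $ i * sg A i) = x $ i * y $ i" for i
    by (simp add: sg_def)
  then show ?thesis
    by (simp only: inner_vec_def vector_matrix_mult_eps inner_real_def)
qed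

lemma inner_perm_mat:
  assumes "invertible g"
  shows "(x v* perm_mat g) \<bullet> (y v* perm_mat g) = x \<bullet> y"
  unfolding inner_vec_def
  by (subst sum.reindex_bij_betw[OF bij_vector_matrix_mult[OF assms], symmetric])
    (simp add: vector_matrix_mult_perm_mat[OF assms])

lemma x0_perm_mat: "invertible g \<Longrightarrow> x\<^sub>0 v* perm_mat g = x\<^sub>0"
  by (subst vec_eq_perm_iff[of g]) (simp_all add: vector_matrix_mult_perm_mat)

lemma matrix_eq_vector_matrix:
  fixes M N :: "real ^ Omega ^ Omega"
  assumes "\<And>x. x v* M = x v* N"
  shows "M = N"
  unfolding vec_eq_iff[where 'b = Omega]
  by (simp only: assms flip: v_vector_matrix_mult) simp

lemma eps_mult: "eps A ** eps B = eps (sym_diff A B)"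
  by (rule matrix_eq_vector_matrix)
    (simp only: vec_eq_iff vector_matrix_mult_eps sg_sym_diff mult.assoc simp_thms
      flip: vector_matrix_mul_assoc)

lemma eps_empty: "eps {} = mat 1"
  by (rule matrix_eq_vector_matrix) (simp add: vec_eq_iff vector_matrix_mult_eps sg_def)

lemma perm_mat_eps_commute:
  assumes "invertible g" and "\<And>\<omega>. \<omega> v* g \<in> C \<longleftrightarrow> \<omega> \<in> C"
  shows "perm_mat g ** eps C = eps C ** perm_mat g"
proof (rule matrix_eq_vector_matrix)
  fix x :: V
  show "x v* (perm_mat g ** eps C) = x v* (eps C ** perm_mat g)"
    unfolding vec_eq_perm_iff[OF assms(1)]
    using assms by (simp add: vector_matrix_mult_perm_mat vector_matrix_mult_eps sg_def
        flip: vector_matrix_mul_assoc)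
qed

lemma inner_x0_eps: "(x\<^sub>0 v* eps A) \<bullet> (x\<^sub>0 v* eps B) = (\<Sum>\<omega>\<in>UNIV. sg A \<omega> * sg B \<omega>)"
  by (simp add: inner_vec_def vector_matrix_mult_eps)

lemma Q_E:
  assumes "q \<in> Q \<omega>\<^sub>1 B\<^sub>0"
  obtains g where "q = perm_mat g" "invertible g" "\<omega>\<^sub>1 v* g = \<omega>\<^sub>1"
    "\<And>\<omega>. \<omega> v* g \<in> B\<^sub>0 \<longleftrightarrow> \<omega> \<in> B\<^sub>0"
proof -
  obtain g where g: "q = perm_mat g" "invertible g" "\<omega>\<^sub>1 v* g = \<omega>\<^sub>1" "(\<lambda>\<omega>. \<omega> v* g) ` B\<^sub>0 = B\<^sub>0"
    using assms by (auto simp: Q_def GL_def)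
  have "\<omega> v* g \<in> B\<^sub>0 \<longleftrightarrow> \<omega> \<in> B\<^sub>0" for \<omega>
    using inj_image_mem_iff[OF bij_is_inj[OF bij_vector_matrix_mult[OF g(2)]], of \<omega> B\<^sub>0]
    by (simp only: g(4))
  with g that show thesis
    by blast
qed

text \<open>Since \<open>C\<close> is invariant under \<open>g\<close>, the vector
  \<open>x\<^sub>0 v* eps C\<close> is fixed by \<open>perm_mat g\<close>, and the permutation
  cancels from both sides.\<close>

lemma inner_x0_eps_perm_mat:
  assumes "invertible g" and "\<And>\<omega>. \<omega> v* g \<in> C \<longleftrightarrow> \<omega> \<in> C"
  shows "(x\<^sub>0 v* (eps A ** perm_mat g)) \<bullet> (x\<^sub>0 v* eps C) = (\<Sum>\<omega>\<in>UNIV. sg A \<omega> * sg C \<omega>)"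
proof -
  have *: "x\<^sub>0 v* eps C = x\<^sub>0 v* eps C v* perm_mat g"
    using perm_mat_eps_commute[OF assms] x0_perm_mat[OF assms(1)]
    by (metis vector_matrix_mul_assoc)
  have "(x\<^sub>0 v* (eps A ** perm_mat g)) \<bullet> (x\<^sub>0 v* eps C) =
      (x\<^sub>0 v* eps A v* perm_mat g) \<bullet> (x\<^sub>0 v* eps C v* perm_mat g)"
    by (subst *) (simp only: vector_matrix_mul_assoc)
  then show ?thesis
    by (simp only: inner_perm_mat[OF assms(1)] inner_x0_eps)
qed

text \<open>\<open>eps C\<close> is an involution.\<close>

lemma generate_eps: "generate GL {eps C} = {mat 1, eps C}"
proof -
  interpret GL: group "GL :: (real ^ Omega ^ Omega) monoid"
    by (rule group_GL)
  have sq: "eps C ** eps C = mat 1"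
    by (simp add: eps_mult eps_empty)
  then have c: "eps C \<in> carrier GL"
    by (auto simp: GL_def invertible_def)
  have inv_eps: "inv\<^bsub>GL\<^esub> (eps C) = eps C"
    using c sq by (intro GL.inv_equality) (simp_all add: GL_def)
  show ?thesis
  proof
    show "generate GL {eps C} \<subseteq> {mat 1, eps C}"
    proof
      fix h assume "h \<in> generate GL {eps C}"
      then show "h \<in> {mat 1, eps C}"
      proof induction
        case (inv h)
        then show ?case
          by (simp only: singleton_iff inv_eps) simp
      next
        case (eng h1 h2)
        then show ?case
          using sq by (auto simp: GL_def)
      qed (auto simp: GL_def)
    qed
    show "{mat 1, eps C} \<subseteq> generate GL {eps C}"
      using generate.one[of GL "{eps C}"] by (auto simp: GL_def intro: generate.incl)
  qed
qed

text \<open>Here \<open>r\<close> is the squared norm, so rescaling divides inner products by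
  \<open>r\<close> itself.\<close>

lemma rescale_equal_norm:
  fixes S :: "'a::euclidean_space set"
  assumes "finite S" and r: "r > 0" and norm: "\<And>x. x \<in> S \<Longrightarrow> x \<bullet> x = r"
    and U: "subspace U" "S \<subseteq> U"
  shows "spherical_code_in U (rescale S)" and "card (rescale S) = card S"
    and "cosines (rescale S) = (\<lambda>t. t / r) ` cosines S"
proof -
  have n: "norm x = sqrt r" if "x \<in> S" for x
    using norm[OF that] by (simp add: norm_eq_sqrt_inner)
  have rs: "rescale S = (\<lambda>x. x /\<^sub>R sqrt r) ` S"
    unfolding rescale_def by (rule image_cong) (simp_all add: n)
  have inj: "inj_on (\<lambda>x. x /\<^sub>R sqrt r) S"
    using r by (auto intro: inj_onI)
  show "card (rescale S) = card S"
    unfolding rs by (rule card_image[OF inj])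
  show "spherical_code_in U (rescale S)"
    using assms n by (auto simp: spherical_code_in_def rs subspace_scale)
  have *: "(x /\<^sub>R sqrt r) \<bullet> (y /\<^sub>R sqrt r) = x \<bullet> y / r" for x y :: 'a
    using r by (simp add: field_simps)
  show "cosines (rescale S) = (\<lambda>t. t / r) ` cosines S"
  proof (intro equalityI subsetI)
    fix t assume "t \<in> cosines (rescale S)"
    then obtain x y where "x \<in> S" "y \<in> S" "x \<noteq> y" "t = x \<bullet> y / r"
      unfolding cosines_def rs using * by (auto simp del: inner_scaleR_left inner_scaleR_right)
    then show "t \<in> (\<lambda>t. t / r) ` cosines S"
      by (auto simp: cosines_def)
  next
    fix t assume "t \<in> (\<lambda>t. t / r) ` cosines S"
    then obtain x y where xy: "x \<in> S" "y \<in> S" "x \<noteq> y" "t = x \<bullet> y / r"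
      by (auto simp: cosines_def)
    then have "x /\<^sub>R sqrt r \<noteq> y /\<^sub>R sqrt r"
      using inj by (meson inj_onD)
    moreover have "t = (x /\<^sub>R sqrt r) \<bullet> (y /\<^sub>R sqrt r)"
      by (simp only: * xy)
    ultimately show "t \<in> cosines (rescale S)"
      using xy unfolding cosines_def rs by blast
  qed
qed

theorem theorem4p13:
  fixes \<omega>\<^sub>1 :: Omega and B\<^sub>0 :: "Omega set" and H :: "(real ^ Omega ^ Omega) set"
  assumes "\<omega>\<^sub>1 \<noteq> 0"
    and "linear_hyperplane B\<^sub>0" and "\<omega>\<^sub>1 \<notin> B\<^sub>0"
    and "H \<in> \<G> \<omega>\<^sub>1 B\<^sub>0"
    and "\<forall>h\<in>H. \<forall>A q. A \<in> RM 2 \<and> q \<in> Q \<omega>\<^sub>1 B\<^sub>0 \<and> h = eps A ** q \<longrightarrow>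
           A \<in> RM 1 \<or> has_defect A 2"
    and "card (row_orbit x\<^sub>0 H) = 64"
  defines "C \<equiv> UNIV - B\<^sub>0"
  defines "H2 \<equiv> H <#>\<^bsub>GL\<^esub> generate GL {eps C}"
  defines "S1 \<equiv> rescale (row_orbit x\<^sub>0 H2)"
  defines "S2 \<equiv> rescale (orth_proj ({v 0}\<^sup>\<bottom>) ` row_orbit x\<^sub>0 H2)"
  shows "(spherical_code_in UNIV S1 \<and> card S1 = 128 \<and> cosines S1 = {-1/4, 0, 1/4}) \<and>
    (spherical_code_in ({v 0}\<^sup>\<bottom>) S2 \<and> card S2 = 128 \<and> cosines S2 = {-1/3, -1/15, 1/5})"
proof -

  \<comment> \<open>The group \<open>H\<close> and the decomposition of its elements\<close>
  interpret GL: group "GL :: (real ^ Omega ^ Omega) monoid"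
    by (rule group_GL)
  have H: "subgroup H GL" and EH: "E \<omega>\<^sub>1 \<subseteq> H" and HJQ: "H \<subseteq> J \<omega>\<^sub>1 <#>\<^bsub>GL\<^esub> Q \<omega>\<^sub>1 B\<^sub>0"
    using assms(4) by (auto simp: \<G>_def)
  have one_H: "mat 1 \<in> H" and mult_H: "\<And>h k. h \<in> H \<Longrightarrow> k \<in> H \<Longrightarrow> h ** k \<in> H"
    using subgroup.one_closed[OF H] subgroup.m_closed[OF H] by (auto simp: GL_def)
  have div_H: "\<exists>k\<in>H. h = k ** h'" if "h \<in> H" "h' \<in> H" for h h'
  proof
    let ?k = "h ** inv\<^bsub>GL\<^esub> h'"
    show "?k \<in> H"
      using that by (intro mult_H subgroup.m_inv_closed[OF H])
    have "inv\<^bsub>GL\<^esub> h' ** h' = mat 1"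
      using GL.l_inv[of h'] subgroup.mem_carrier[OF H that(2)] by (simp add: GL_def)
    then show "h = ?k ** h'"
      by (simp flip: matrix_mul_assoc)
  qed
  have C1: "\<omega>\<^sub>1 \<in> C" and C0: "0 \<notin> C"
    using assms(2,3) by (auto simp: C_def linear_hyperplane_def vec.subspace_0)
  have CRM: "C \<in> RM 1"
    unfolding C_def using assms(2,3) by (rule Compl_hyperplane_RM_1)
  have decomp: "\<exists>A g. h = eps A ** perm_mat g \<and> A \<in> RM 2 \<and> 0 \<notin> A \<and> \<omega>\<^sub>1 \<notin> A \<and>
      invertible g \<and> \<omega>\<^sub>1 v* g = \<omega>\<^sub>1 \<and> (\<forall>\<omega>. \<omega> v* g \<in> C \<longleftrightarrow> \<omega> \<in> C) \<and> (A \<in> RM 1 \<or> has_defect A 2)"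
    if "h \<in> H" for h
  proof -
    have "h \<in> J \<omega>\<^sub>1 <#>\<^bsub>GL\<^esub> Q \<omega>\<^sub>1 B\<^sub>0"
      using HJQ that by blast
    then obtain A q where h: "h = eps A ** q" and A: "A \<in> RM 2" "0 \<notin> A" "\<omega>\<^sub>1 \<notin> A"
      and q: "q \<in> Q \<omega>\<^sub>1 B\<^sub>0"
      by (auto simp: set_mult_def J_def GL_def)
    obtain g where g: "q = perm_mat g" "invertible g" "\<omega>\<^sub>1 v* g = \<omega>\<^sub>1"
      "\<And>\<omega>. \<omega> v* g \<in> B\<^sub>0 \<longleftrightarrow> \<omega> \<in> B\<^sub>0"
      using q by (rule Q_E) blast
    have "A \<in> RM 1 \<or> has_defect A 2"
      using assms(5) that A(1) q h by blast
    with g h A show ?thesis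
      by (intro exI[of _ A] exI[of _ g]) (simp add: C_def)
  qed

  \<comment> \<open>Inner products of orbit vectors with \<open>x\<^sub>0\<close> and
    \<open>c\<close>\<close>
  define T where "T h = x\<^sub>0 v* h" for h :: "real ^ Omega ^ Omega"
  define T' where "T' h = x\<^sub>0 v* (h ** eps C)" for h :: "real ^ Omega ^ Omega"
  define c where "c = x\<^sub>0 v* eps C"
  have T_1: "T (mat 1) = x\<^sub>0" and T'_1: "T' (mat 1) = c"
    by (simp_all add: T_def T'_def c_def)
  have H_iso: "(x v* h) \<bullet> (y v* h) = x \<bullet> y" if "h \<in> H" for x y h
    using decomp[OF that] by (auto simp: inner_eps inner_perm_mat simp flip: vector_matrix_mul_assoc)
  have x0_eps_empty: "x\<^sub>0 v* eps {} = x\<^sub>0"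
    by (simp add: eps_empty)
  have inner_T: "T (eps A ** perm_mat g) \<bullet> x\<^sub>0 = (\<Sum>\<omega>\<in>UNIV. sg A \<omega>)" if "invertible g" for A g
    using inner_x0_eps_perm_mat[OF that, of "{}" A] by (simp add: T_def x0_eps_empty sg_def)
  have inner_Tc: "T (eps A ** perm_mat g) \<bullet> c = (\<Sum>\<omega>\<in>UNIV. sg A \<omega> * sg C \<omega>)"
    if "invertible g" "\<forall>\<omega>. \<omega> v* g \<in> C \<longleftrightarrow> \<omega> \<in> C" for A g
    unfolding T_def c_def using that by (intro inner_x0_eps_perm_mat) auto

  \<comment> \<open>The case \<open>T k = x\<^sub>0\<close> is kept apart because it gives 16.
    \<open>val_RM_1\<close> records that any other nonzero product with \<open>x\<^sub>0\<close>
    comes from a word of defect 2.\<close>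
  have val: "T k \<bullet> x\<^sub>0 \<in> {4, - 4} \<or> T k \<bullet> x\<^sub>0 = 0 \<or> T k = x\<^sub>0" and val_c: "T k \<bullet> c \<in> {- 4, 0, 4}"
    and val_RM_1: "T k \<bullet> x\<^sub>0 = 0 \<or> T k = x\<^sub>0 \<or>
      (\<exists>A g. k = eps A ** perm_mat g \<and> invertible g \<and> (\<forall>\<omega>. \<omega> v* g \<in> C \<longleftrightarrow> \<omega> \<in> C) \<and>
        0 \<notin> A \<and> has_defect A 2)"
    if k_H: "k \<in> H" for k
  proof -
    obtain A g where k: "k = eps A ** perm_mat g" and A: "A \<in> RM 2" "0 \<notin> A" "\<omega>\<^sub>1 \<notin> A"
      and g: "invertible g" "\<forall>\<omega>. \<omega> v* g \<in> C \<longleftrightarrow> \<omega> \<in> C" and A12: "A \<in> RM 1 \<or> has_defect A 2"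
      using decomp[OF k_H] by blast
    from A12 consider "A = {}" | "A \<in> RM 1" "A \<noteq> {}" | "has_defect A 2"
      by blast
    then have "(T k \<bullet> x\<^sub>0 \<in> {4, - 4} \<and> has_defect A 2 \<or> T k \<bullet> x\<^sub>0 = 0 \<or> T k = x\<^sub>0) \<and>
      T k \<bullet> c \<in> {- 4, 0, 4}"
    proof cases
      case 1
      then have "T k = x\<^sub>0"
        by (simp add: k T_def eps_empty x0_perm_mat g)
      moreover have "T k \<bullet> c = 0"
        unfolding k inner_Tc[OF g] using sum_sg_RM_1[OF CRM C0] C1 by (auto simp: 1 sg_def)
      ultimately show ?thesis
        by simp
    next
      case 2
      have "T k \<bullet> x\<^sub>0 = 0"
        unfolding k inner_T[OF g(1)] using 2 A by (intro sum_sg_RM_1) auto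
      moreover have "T k \<bullet> c = 0"
        unfolding k inner_Tc[OF g] sg_sym_diff[symmetric]
        using 2 A C0 C1 CRM by (intro sum_sg_RM_1 RM_sym_diff) auto
      ultimately show ?thesis
        by simp
    next
      case 3
      have "T k \<bullet> x\<^sub>0 \<in> {4, - 4}"
        unfolding k inner_T[OF g(1)] using sum_sg_defect_2[OF 3 empty_in_RM] by (simp add: sg_def)
      moreover have "T k \<bullet> c \<in> {4, - 4}"
        unfolding k inner_Tc[OF g] by (rule sum_sg_defect_2[OF 3 CRM])
      ultimately show ?thesis
        using 3 by auto
    qed
    then show "T k \<bullet> x\<^sub>0 \<in> {4, - 4} \<or> T k \<bullet> x\<^sub>0 = 0 \<or> T k = x\<^sub>0" "T k \<bullet> c \<in> {- 4, 0, 4}"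
      "T k \<bullet> x\<^sub>0 = 0 \<or> T k = x\<^sub>0 \<or>
      (\<exists>A g. k = eps A ** perm_mat g \<and> invertible g \<and> (\<forall>\<omega>. \<omega> v* g \<in> C \<longleftrightarrow> \<omega> \<in> C) \<and>
        0 \<notin> A \<and> has_defect A 2)"
      using k g A by blast+
  qed

  \<comment> \<open>Reduction of arbitrary pairs to pairs with a base vector\<close>
  have T_mult: "T (k ** h) = T k v* h" for k h
    by (simp add: T_def vector_matrix_mul_assoc)
  \<comment> \<open>\<open>eps C\<close> commutes with all of \<open>H\<close>, so the second half
    of the orbit is the orbit of \<open>c\<close>.\<close>
  have T'_eq: "T' h = c v* h" if h_H: "h \<in> H" for h
  proof -
    obtain A g where h: "h = eps A ** perm_mat g"
      and g: "invertible g" "\<forall>\<omega>. \<omega> v* g \<in> C \<longleftrightarrow> \<omega> \<in> C"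
      using decomp[OF h_H] by blast
    have "h ** eps C = eps A ** (eps C ** perm_mat g)"
      using perm_mat_eps_commute[OF g(1), of C] g(2) by (simp add: h flip: matrix_mul_assoc)
    also have "eps A ** (eps C ** perm_mat g) = eps C ** h"
      by (simp add: h matrix_mul_assoc eps_mult Un_commute)
    finally show ?thesis
      by (simp add: T'_def c_def vector_matrix_mul_assoc)
  qed
  have T'_T': "T' h \<bullet> T' h' = T h \<bullet> T h'" for h h'
    by (simp add: T'_def T_def inner_eps flip: vector_matrix_mul_assoc)
  have T_T: "\<exists>k\<in>H. h = k ** h' \<and> T h \<bullet> T h' = T k \<bullet> x\<^sub>0 \<and> T h \<bullet> T' h' = T k \<bullet> c"
    if "h \<in> H" "h' \<in> H" for h h'
  proof -
    obtain k where k: "k \<in> H" "h = k ** h'"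
      using div_H[OF \<open>h \<in> H\<close> \<open>h' \<in> H\<close>] by blast
    have "T h \<bullet> T h' = T k \<bullet> x\<^sub>0"
      using H_iso[OF \<open>h' \<in> H\<close>, of "T k" x\<^sub>0] unfolding k T_mult by (simp add: T_def)
    moreover have "T h \<bullet> T' h' = T k \<bullet> c"
      using H_iso[OF \<open>h' \<in> H\<close>, of "T k" c] T'_eq[OF that(2)] unfolding k T_mult by simp
    ultimately show ?thesis
      using k by blast
  qed

  \<comment> \<open>Inner products in the enlarged orbit\<close>
  define X where "X = row_orbit x\<^sub>0 H2"
  have X_eq: "X = T ` H \<union> T' ` H"
    unfolding X_def H2_def generate_eps row_orbit_def set_mult_def T_def T'_def
    by (auto simp: GL_def)
  have x0_x0: "x\<^sub>0 \<bullet> x\<^sub>0 = 16"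
    using inner_x0_eps[of "{}" "{}"] by (simp add: x0_eps_empty card_bit)
  have T_norm: "T h \<bullet> T h = 16" if "h \<in> H" for h
    using H_iso[OF that, of x\<^sub>0 x\<^sub>0] by (simp add: T_def x0_x0)
  have X_norm: "y \<bullet> y = 16" if "y \<in> X" for y
    using that T_norm by (auto simp: X_eq T'_T')
  have T_inner: "T h \<bullet> T h' \<in> {- 4, 0, 4}" if hh': "h \<in> H" "h' \<in> H" "T h \<noteq> T h'" for h h'
  proof -
    obtain k where k: "k \<in> H" "h = k ** h'" "T h \<bullet> T h' = T k \<bullet> x\<^sub>0"
      using T_T[OF hh'(1,2)] by blast
    have "T k \<noteq> x\<^sub>0"
      using hh'(3) unfolding k(2) T_mult by (auto simp: T_def)
    then show ?thesis
      using val[OF k(1)] k(3) by auto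
  qed
  have T_T'_inner: "T h \<bullet> T' h' \<in> {- 4, 0, 4}" if "h \<in> H" "h' \<in> H" for h h'
    using T_T[OF that] val_c by metis
  have T'_inj: "T' h = T' h' \<longleftrightarrow> T h = T h'" for h h'
    by (auto simp: T'_def T_def vec_eq_iff vector_matrix_mult_eps sg_def simp flip: vector_matrix_mul_assoc)
  have X_inner: "y \<bullet> y' \<in> {- 4, 0, 4}" if "y \<in> X" "y' \<in> X" "y \<noteq> y'" for y y'
    using that T_inner T_T'_inner unfolding X_eq
    by (elim UnE imageE) (auto simp: T'_T' T'_inj inner_commute[of "T' _" "T _"])

  \<comment> \<open>Size of the enlarged orbit\<close>
  have card_T: "card (T ` H) = 64"
    using assms(6) by (simp add: row_orbit_def T_def)
  then have fin_T: "finite (T ` H)"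
    by (intro card_ge_0_finite) simp
  have T'_image: "T' ` H = (\<lambda>x. x v* eps C) ` T ` H"
    by (simp add: image_image T'_def T_def vector_matrix_mul_assoc)
  have "inj (\<lambda>x. x v* eps C)"
    by (rule injI) (auto simp: vec_eq_iff vector_matrix_mult_eps sg_def split: if_splits)
  then have card_T': "card (T' ` H) = 64"
    unfolding T'_image using card_T by (subst card_image) (auto intro: inj_on_subset)
  \<comment> \<open>Equal vectors would have inner product 16, which is not among the possible
    values across the two halves.\<close>
  have "T h \<noteq> T' h'" if "h \<in> H" "h' \<in> H" for h h'
    using T_T'_inner[OF that] T_norm[OF that(1)] by auto
  then have "T ` H \<inter> T' ` H = {}"
    by auto
  then have card_X: "card X = 128"
    unfolding X_eq using fin_T card_T card_T' by (subst card_Un_disjoint) (auto simp: T'_image)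
  have fin_X: "finite X"
    unfolding X_eq T'_image using fin_T by simp

  \<comment> \<open>Existence of a bent word in \<open>H\<close>\<close>
  have "\<exists>h\<in>H. \<exists>A g. h = eps A ** perm_mat g \<and> invertible g \<and> (\<forall>\<omega>. \<omega> v* g \<in> C \<longleftrightarrow> \<omega> \<in> C) \<and>
    0 \<notin> A \<and> has_defect A 2"
  proof (rule ccontr)
    assume no: "\<not> ?thesis"
    \<comment> \<open>Without a bent word only the value 0 is left for distinct vectors, and 64
      nonzero orthogonal vectors do not fit into dimension 16.\<close>
    have "pairwise orthogonal (T ` H)"
    proof (rule pairwiseI)
      fix y y' assume "y \<in> T ` H" "y' \<in> T ` H" "y \<noteq> y'"
      then obtain h h' where hh': "h \<in> H" "h' \<in> H" "y = T h" "y' = T h'"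
        by blast
      obtain k where k: "k \<in> H" "h = k ** h'" "T h \<bullet> T h' = T k \<bullet> x\<^sub>0"
        using T_T[OF hh'(1,2)] by blast
      have "T k \<noteq> x\<^sub>0"
        using \<open>y \<noteq> y'\<close> unfolding hh' k(2) T_mult by (auto simp: T_def)
      then show "orthogonal y y'"
        using val_RM_1[OF k(1)] k(1,3) hh' no unfolding orthogonal_def by metis
    qed
    moreover have "0 \<notin> T ` H"
      using T_norm by force
    ultimately have "independent (T ` H)"
      by (rule pairwise_orthogonal_independent)
    then have "card (T ` H) \<le> DIM(V)"
      using independent_bound by blast
    then show False
      using card_T by (simp add: card_bit)
  qed
  then obtain h A g where h: "h \<in> H" "h = eps A ** perm_mat g"
    and g: "invertible g" "\<forall>\<omega>. \<omega> v* g \<in> C \<longleftrightarrow> \<omega> \<in> C" and A: "0 \<notin> A" "has_defect A 2"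
    by blast

  \<comment> \<open>Attainment of every inner product\<close>
  have attained: "\<exists>y\<in>X. \<exists>y'\<in>X. y \<bullet> y' = t" if t: "t \<in> {4, - 4}" for t
  proof -
    obtain a where a: "(\<Sum>x\<in>UNIV. sg A x * sg (lin_word a) x) = t"
      using sum_sg_defect_2_attained[OF A(2,1) t] .
    \<comment> \<open>\<open>L\<close> is the linear word, corrected by \<open>C\<close> where
      necessary to avoid \<open>\<omega>\<^sub>1\<close>, so that \<open>eps L\<close> lies in
      \<open>E \<omega>\<^sub>1\<close>.\<close>
    define L where "L = (if \<omega>\<^sub>1 \<in> lin_word a then sym_diff (lin_word a) C else lin_word a)"
    have "L \<in> RM 1" "0 \<notin> L" "\<omega>\<^sub>1 \<notin> L"
      using C0 C1 CRM lin_word_RM_1 by (auto simp: L_def intro: RM_sym_diff)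
    then have "eps L \<in> H"
      using EH by (auto simp: E_def)
    then have k: "eps L ** h \<in> H"
      using h by (intro mult_H)
    have k_eq: "eps L ** h = eps (sym_diff L A) ** perm_mat g"
      by (simp only: h matrix_mul_assoc eps_mult)
    show ?thesis
    proof (cases "\<omega>\<^sub>1 \<in> lin_word a")
      case True
      \<comment> \<open>Pairing with \<open>c\<close> instead of \<open>x\<^sub>0\<close>
        contributes a second \<open>C\<close>, which cancels the correction in
        \<open>L\<close>.\<close>
      have "T (eps L ** h) \<bullet> T' (mat 1) = (\<Sum>\<omega>\<in>UNIV. sg (sym_diff L A) \<omega> * sg C \<omega>)"
        unfolding k_eq T'_1 by (rule inner_Tc[OF g])
      also have "\<dots> = t"
        using a True by (simp only: L_def if_True sg_sym_diff) (simp add: ac_simps)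
      finally show ?thesis
        using k one_H unfolding X_eq by blast
    next
      case False
      have "T (eps L ** h) \<bullet> T (mat 1) = (\<Sum>\<omega>\<in>UNIV. sg (sym_diff L A) \<omega>)"
        unfolding k_eq T_1 by (rule inner_T[OF g(1)])
      also have "\<dots> = t"
        using a False by (simp only: L_def if_False sg_sym_diff) (simp add: ac_simps)
      finally show ?thesis
        using k one_H unfolding X_eq by blast
    qed
  qed
  have "x\<^sub>0 \<bullet> c = (\<Sum>\<omega>\<in>UNIV. sg C \<omega>)"
    using inner_x0_eps[of "{}" C] by (simp add: c_def x0_eps_empty sg_def)
  also have "\<dots> = 0"
    using sum_sg_RM_1[OF CRM C0] C1 by blast
  finally have "T (mat 1) \<bullet> T' (mat 1) = 0"
    by (simp add: T_1 T'_1)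
  then have "\<exists>y\<in>X. \<exists>y'\<in>X. y \<bullet> y' = 0"
    using one_H unfolding X_eq by blast
  with attained have att: "\<exists>y\<in>X. \<exists>y'\<in>X. y \<bullet> y' = t" if "t \<in> {- 4, 0, 4}" for t
    using that by blast
  have cos_X: "cosines X = {- 4, 0, 4}"
  proof
    show "cosines X \<subseteq> {- 4, 0, 4}"
      using X_inner by (auto simp: cosines_def)
    show "{- 4, 0, 4} \<subseteq> cosines X"
    proof
      fix t :: real assume t: "t \<in> {- 4, 0, 4}"
      then obtain y y' where y: "y \<in> X" "y' \<in> X" "y \<bullet> y' = t"
        using att by blast
      then have "y \<noteq> y'"
        using X_norm[of y] t by auto
      with y show "t \<in> cosines X"
        by (auto simp: cosines_def)
    qed
  qed

  \<comment> \<open>Projection along \<open>v 0\<close> and the two codes\<close>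
  have X_0: "y $ 0 = 1" if "y \<in> X" for y
  proof -
    have T0: "T h $ 0 = 1" if h_H: "h \<in> H" for h
    proof -
      obtain A g where "h = eps A ** perm_mat g" "0 \<notin> A" "invertible g"
        using decomp[OF h_H] by blast
      then show ?thesis
        using vector_matrix_mult_perm_mat[of g "x\<^sub>0 v* eps A" 0]
        by (simp add: T_def vector_matrix_mult_eps sg_def flip: vector_matrix_mul_assoc)
    qed
    have "T' h $ 0 = T h $ 0" for h
      using C0 by (simp add: T'_def T_def vector_matrix_mult_eps sg_def flip: vector_matrix_mul_assoc)
    then show ?thesis
      using that T0 by (auto simp: X_eq)
  qed
  define p where "p y = y - v 0" for y :: V
  \<comment> \<open>With coordinate 1 at 0 throughout the orbit, the projection is the translation
    by \<open>- v 0\<close>, hence injective.\<close>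
  have proj: "orth_proj ({v 0}\<^sup>\<bottom>) y = p y" if "y \<in> X" for y
    using X_0[OF that] by (subst orth_proj_unit) (simp_all add: p_def inner_axis)
  have p_X: "orth_proj ({v 0}\<^sup>\<bottom>) ` X = p ` X"
    using proj by (intro image_cong) auto
  have p_inner: "p y \<bullet> p y' = y \<bullet> y' - 1" if "y \<in> X" "y' \<in> X" for y y'
    using X_0[OF that(1)] X_0[OF that(2)]
    by (simp add: p_def inner_diff_left inner_diff_right inner_axis inner_axis' inner_commute)
  have inj_p: "inj p"
    by (auto simp: p_def intro: injI)
  have cos_pX: "cosines (p ` X) = (\<lambda>t. t - 1) ` cosines X"
  proof (intro equalityI subsetI)
    fix t assume "t \<in> cosines (p ` X)"
    then obtain y y' where y: "y \<in> X" "y' \<in> X" "p y \<noteq> p y'" and "t = p y \<bullet> p y'"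
      by (auto simp: cosines_def)
    then have "t = y \<bullet> y' - 1" "y \<noteq> y'"
      using p_inner by auto
    with y show "t \<in> (\<lambda>t. t - 1) ` cosines X"
      unfolding cosines_def by blast
  next
    fix t assume "t \<in> (\<lambda>t. t - 1) ` cosines X"
    then obtain y y' where y: "y \<in> X" "y' \<in> X" "y \<noteq> y'" and "t = y \<bullet> y' - 1"
      by (auto simp: cosines_def)
    then have "t = p y \<bullet> p y'" "p y \<noteq> p y'"
      using p_inner inj_p by (auto dest: injD)
    with y show "t \<in> cosines (p ` X)"
      unfolding cosines_def by blast
  qed
  have pX_sub: "p ` X \<subseteq> {v 0}\<^sup>\<bottom>"
    using X_0 by (auto simp: orthogonal_comp_def orthogonal_def p_def inner_diff_right inner_axis inner_axis')
  note X_code = rescale_equal_norm[OF fin_X _ X_norm subspace_UNIV subset_UNIV]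
  have "y \<bullet> y = 15" if "y \<in> p ` X" for y
    using that X_norm by (auto simp: p_inner)
  note pX_code = rescale_equal_norm[OF finite_imageI[OF fin_X] _ this subspace_orthogonal_comp pX_sub]
  have "card (p ` X) = 128"
    using card_image[OF inj_on_subset[OF inj_p, of X]] card_X by simp
  \<comment> \<open>The inner products -4, 0, 4 drop to -5, -1, 3 and the squared norm 16 to 15; the
    quotients are -1/3, -1/15, 1/5.\<close>
  then have "spherical_code_in ({v 0}\<^sup>\<bottom>) S2" "card S2 = 128" "cosines S2 = {-1/3, -1/15, 1/5}"
    using pX_code unfolding S2_def X_def[symmetric] p_X by (simp_all add: cos_pX cos_X)
  moreover have "spherical_code_in UNIV S1" "card S1 = 128" "cosines S1 = {-1/4, 0, 1/4}"
    using X_code unfolding S1_def X_def[symmetric] by (simp_all add: card_X cos_X)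
  ultimately show ?thesis
    by blast
qed

end
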